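(* Let $P$ be the transition matrix of an ergodic Markov chain on $[N]=\{1,\dots,N\}$ with stationary distribution $\pi^*$. Let $m\ge1$ and let $B_1,\dots,B_m\subseteq[N]$ be such that $\bigcup_{l=1}^mB_l=[N]$, and run the RLGL algorithm with $P$ and the deterministic cyclic green-light sets $G_{nm+l}=B_l$, $n\ge0$, $1\le l\le m$. Denote by $$P(\mathbf{G}_m)=\prod_{l=1}^mP(G_l)=P(G_1)P(G_2)\cdots P(G_m)$$ the transition probability matrix of one complete cycle. Suppose that for some integer $r\ge1$ and some $j_0\in[N]$, $$\left(\left(P(\mathbf{G}_m)\right)^r\right)_{ij_0}>0\quad\text{for all } i\in[N],$$ and let $\eta=\inf_i\left(\left(P(\mathbf{G}_m)\right)^r\right)_{ij_0}$. Then (for $\eta<1$, so that the right-hand side is defined) $$\|C_t\|_1=\mathbb{E}(\|C_t\|_1)\le 2\,[1-\eta^2]^{-1}(1-\eta^2)^{\frac{t}{rm}},\qquad t\ge0 .$$ If, in addition, $\inf_{t>0}|H_t\mathbf{1}|>0$, then $\|\hat\pi_t-\pi^*\|_1=O\left((1-\eta^2)^{\frac{t}{rm}}\right)$ as $t\to\infty$.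
   Context: Ergodic means irreducible and aperiodic (finite state space). All vectors indexed by states are row vectors in $\mathbb{R}^N$; $\mathbf{1}$ is the column vector of ones; $\|\cdot\|_1$ is the sum of absolute values. RLGL algorithm. The input is a stochastic matrix $P$ and a sequence $\mathbf{G}=(G_0,G_1,\dots)$ of subsets of $[N]$ with $G_0=[N]$. For $G\subseteq[N]$ let $I(G)$ be the diagonal matrix with $I(G)_{ii}=1$ if $i\in G$ and all other entries $0$, and let $P(G)=I-I(G)(I-P)$, the stochastic matrix whose rows $i\in G$ are those of $P$ and whose other rows are those of the identity matrix. Start with $C_0=\mathbf{0}$, $H_0=\mathbf{0}$, and $M_0$ a fixed probability distribution on $[N]$ (usually uniform). Recursively, $$M_t=C_tI(G_t)\ (t\ge1),\qquad H_{t+1}=H_t+M_t\ (t\ge0),\qquad C_{t+1}=C_t-M_t(I-P)\ (t\ge0).$$ The estimate of $\pi^*$ is $\hat\pi_t=H_t/(H_t\mathbf{1})$, $t\ge1$ (when $H_t\mathbf{1}\neq0$). *)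

theory Defs
  imports
    "HOL-Analysis.Analysis"
    "HOL-Probability.Probability_Mass_Function"
    "HOL-Library.Landau_Symbols"
begin

definition norm1 :: "real ^ 'n \<Rightarrow> real" where
  "norm1 x = (\<Sum>i\<in>UNIV. \<bar>x $ i\<bar>)"

text \<open>The product of a row vector with the column vector of ones.\<close>
definition coord_sum :: "real ^ 'n \<Rightarrow> real" where
  "coord_sum x = (\<Sum>i\<in>UNIV. x $ i)"

text \<open>The type \<open>real ^ 'n ^ 'n\<close> carries the componentwise product as \<open>*\<close>, so the
  library's \<open>^\<close> and \<open>prod_list\<close> are not the matrix operations; these two are built on \<open>**\<close>.\<close>
primrec matrix_power :: "real ^ 'n ^ 'n \<Rightarrow> nat \<Rightarrow> real ^ 'n ^ 'n" where
  "matrix_power A 0 = mat 1"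
| "matrix_power A (Suc k) = A ** matrix_power A k"

definition matrix_prod_list :: "(real ^ 'n ^ 'n) list \<Rightarrow> real ^ 'n ^ 'n" where
  "matrix_prod_list As = foldr (**) As (mat 1)"

definition probability_vector :: "real ^ 'n \<Rightarrow> bool" where
  "probability_vector x \<longleftrightarrow> (\<forall>i. 0 \<le> x $ i) \<and> coord_sum x = 1"

definition stochastic_matrix :: "real ^ 'n ^ 'n \<Rightarrow> bool" where
  "stochastic_matrix P \<longleftrightarrow> (\<forall>i. probability_vector (P $ i))"

text \<open>Allowing \<open>k = 0\<close> is harmless: for a stochastic matrix it makes a difference neither in
  dimension 1, where the only entry is 1, nor in higher dimension, where a return path
  from \<open>i\<close> to \<open>i\<close> passes through some other state.\<close>
definition irreducible_matrix :: "real ^ 'n ^ 'n \<Rightarrow> bool" where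
  "irreducible_matrix P \<longleftrightarrow> (\<forall>i j. \<exists>k. matrix_power P k $ i $ j > 0)"

definition aperiodic_matrix :: "real ^ 'n ^ 'n \<Rightarrow> bool" where
  "aperiodic_matrix P \<longleftrightarrow> (\<forall>i. Gcd {k::nat. 1 \<le> k \<and> matrix_power P k $ i $ i > 0} = 1)"

definition ergodic_matrix :: "real ^ 'n ^ 'n \<Rightarrow> bool" where
  "ergodic_matrix P \<longleftrightarrow> stochastic_matrix P \<and> irreducible_matrix P \<and> aperiodic_matrix P"

definition stationary_distribution :: "real ^ 'n ^ 'n \<Rightarrow> real ^ 'n \<Rightarrow> bool" where
  "stationary_distribution P x \<longleftrightarrow> probability_vector x \<and> x v* P = x"

definition selector_matrix :: "'n set \<Rightarrow> real ^ 'n ^ 'n" where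
  "selector_matrix G = (\<chi> i j. if i = j \<and> i \<in> G then 1 else 0)"

text \<open>The rows indexed by \<open>G\<close> are those of \<open>P\<close>; the other rows are those of the identity.\<close>
definition green_matrix :: "real ^ 'n ^ 'n \<Rightarrow> 'n set \<Rightarrow> real ^ 'n ^ 'n" where
  "green_matrix P G = mat 1 - selector_matrix G ** (mat 1 - P)"

text \<open>Row vectors act from the left through \<open>v*\<close>. The set \<open>G 0\<close> plays no role in the
  recursion, since the first move is prescribed to be \<open>M0\<close>.\<close>
fun rlgl_M :: "real ^ 'n ^ 'n \<Rightarrow> real ^ 'n \<Rightarrow> (nat \<Rightarrow> 'n set) \<Rightarrow> nat \<Rightarrow> real ^ 'n"
  and rlgl_C :: "real ^ 'n ^ 'n \<Rightarrow> real ^ 'n \<Rightarrow> (nat \<Rightarrow> 'n set) \<Rightarrow> nat \<Rightarrow> real ^ 'n" where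
  "rlgl_M P M0 G 0 = M0"
| "rlgl_M P M0 G (Suc t) = rlgl_C P M0 G (Suc t) v* selector_matrix (G (Suc t))"
| "rlgl_C P M0 G 0 = 0"
| "rlgl_C P M0 G (Suc t) = rlgl_C P M0 G t - rlgl_M P M0 G t v* (mat 1 - P)"

primrec rlgl_H :: "real ^ 'n ^ 'n \<Rightarrow> real ^ 'n \<Rightarrow> (nat \<Rightarrow> 'n set) \<Rightarrow> nat \<Rightarrow> real ^ 'n" where
  "rlgl_H P M0 G 0 = 0"
| "rlgl_H P M0 G (Suc t) = rlgl_H P M0 G t + rlgl_M P M0 G t"

text \<open>Meaningful only when the coordinate sum is nonzero; otherwise the value is 0.\<close>
definition rlgl_estimate ::
    "real ^ 'n ^ 'n \<Rightarrow> real ^ 'n \<Rightarrow> (nat \<Rightarrow> 'n set) \<Rightarrow> nat \<Rightarrow> real ^ 'n" where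
  "rlgl_estimate P M0 G t = rlgl_H P M0 G t /\<^sub>R coord_sum (rlgl_H P M0 G t)"

definition cycle_matrix :: "real ^ 'n ^ 'n \<Rightarrow> (nat \<Rightarrow> 'n set) \<Rightarrow> nat \<Rightarrow> real ^ 'n ^ 'n" where
  "cycle_matrix P G m = matrix_prod_list (map (\<lambda>l. green_matrix P (G l)) [1..<Suc m])"

end

theory Submission imports Defs begin

text \<open>For \<open>t \<ge> 1\<close> the cash vector evolves by \<open>C (t + 1) = C t P(G t)\<close> and has coordinate sum 0.
  The \<open>r\<close>-th power of the cycle matrix dominates \<open>\<eta>\<close> in column \<open>j0\<close>, so subtracting the constant
  \<open>\<eta>\<close> from that column changes nothing on vectors of sum 0 and leaves a nonnegative matrix with
  row sums \<open>1 - \<eta>\<close>. Hence each block of \<open>r m\<close> steps contracts \<open>norm1\<close> by \<open>1 - \<eta> \<le> 1 - \<eta>\<^sup>2\<close>.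
  For the estimate, \<open>H t (I - P) = - C t\<close>, and by irreducibility \<open>I - P\<close> is injective,
  hence bounded below, on the vectors of sum 0, one of which is \<open>H t - (H t 1) \<pi>\<^sup>*\<close>.\<close>

section \<open>The 1-norm and the coordinate sum\<close>

lemma norm1_nonneg: "0 \<le> norm1 x"
  by (simp add: norm1_def sum_nonneg)

lemma norm1_0 [simp]: "norm1 0 = 0"
  by (simp add: norm1_def)

lemma norm1_triangle_diff: "norm1 (x - y) \<le> norm1 x + norm1 y"
  unfolding norm1_def sum.distrib[symmetric] by (rule sum_mono) simp

lemma norm1_scaleR: "norm1 (c *\<^sub>R x) = \<bar>c\<bar> * norm1 x"
  by (simp add: norm1_def abs_mult sum_distrib_left)

lemma norm1_probability_vector: "probability_vector x \<Longrightarrow> norm1 x = 1"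
  by (simp add: probability_vector_def norm1_def coord_sum_def)

lemma norm1_le_card_mult_norm: "norm1 (x :: real ^ 'n) \<le> real CARD('n) * norm x"
proof -
  have "norm1 x \<le> (\<Sum>i\<in>(UNIV :: 'n set). norm x)"
    unfolding norm1_def by (rule sum_mono) (rule component_le_norm_cart)
  then show ?thesis by simp
qed

lemma norm_le_norm1: "norm x \<le> norm1 x"
  unfolding norm1_def by (rule norm_le_l1_cart)

lemma coord_sum_0 [simp]: "coord_sum 0 = 0"
  by (simp add: coord_sum_def)

lemma coord_sum_add: "coord_sum (x + y) = coord_sum x + coord_sum y"
  by (simp add: coord_sum_def sum.distrib)

lemma coord_sum_diff: "coord_sum (x - y) = coord_sum x - coord_sum y"
  by (simp add: coord_sum_def sum_subtractf)

lemma coord_sum_scaleR: "coord_sum (c *\<^sub>R x) = c * coord_sum x"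
  by (simp add: coord_sum_def sum_distrib_left)

section \<open>Stochastic matrices and green-light matrices\<close>

lemma vector_matrix_mult_nth:
  fixes x :: "real ^ 'm"
  shows "(x v* A) $ j = (\<Sum>i\<in>UNIV. A $ i $ j * x $ i)"
  by (simp add: vector_matrix_mult_def mult.commute)

lemma matrix_matrix_mult_nth: "(A ** B) $ i $ j = (\<Sum>k\<in>UNIV. A $ i $ k * B $ k $ j)"
  by (simp add: matrix_matrix_mult_def)

lemma stochastic_matrix_iff:
  "stochastic_matrix A \<longleftrightarrow> (\<forall>i j. 0 \<le> A $ i $ j) \<and> (\<forall>i. (\<Sum>j\<in>UNIV. A $ i $ j) = 1)"
  by (auto simp: stochastic_matrix_def probability_vector_def coord_sum_def)

lemma stochastic_matrix_entry_le_1: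
  assumes "stochastic_matrix A"
  shows "A $ i $ j \<le> 1"
proof -
  have "A $ i $ j \<le> (\<Sum>j\<in>UNIV. A $ i $ j)"
    using assms by (intro member_le_sum) (auto simp: stochastic_matrix_iff)
  then show ?thesis using assms by (simp add: stochastic_matrix_iff)
qed

lemma stochastic_matrix_mat_1: "stochastic_matrix (mat 1)"
  by (auto simp: stochastic_matrix_iff mat_def)

lemma stochastic_matrix_mult:
  assumes "stochastic_matrix A" "stochastic_matrix B"
  shows "stochastic_matrix (A ** B)"
proof -
  have "(\<Sum>j\<in>UNIV. (A ** B) $ i $ j) = 1" for i
  proof -
    have "(\<Sum>j\<in>UNIV. (A ** B) $ i $ j) = (\<Sum>k\<in>UNIV. A $ i $ k * (\<Sum>j\<in>UNIV. B $ k $ j))"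
      unfolding matrix_matrix_mult_nth sum_distrib_left by (rule sum.swap)
    then show ?thesis using assms by (simp add: stochastic_matrix_iff)
  qed
  then show ?thesis
    using assms by (auto simp: stochastic_matrix_iff matrix_matrix_mult_nth intro!: sum_nonneg)
qed

lemma stochastic_matrix_power: "stochastic_matrix A \<Longrightarrow> stochastic_matrix (matrix_power A k)"
  by (induction k) (auto intro: stochastic_matrix_mult stochastic_matrix_mat_1)

lemma stochastic_matrix_prod_list:
  "(\<And>A. A \<in> set As \<Longrightarrow> stochastic_matrix A) \<Longrightarrow> stochastic_matrix (matrix_prod_list As)"
  by (induction As)
    (auto simp: matrix_prod_list_def intro: stochastic_matrix_mult stochastic_matrix_mat_1)

lemma green_matrix_nth: "green_matrix P G $ i $ j = (if i \<in> G then P $ i $ j else mat 1 $ i $ j)"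
proof -
  have "(selector_matrix G ** (mat 1 - P)) $ i $ j
      = (\<Sum>k\<in>UNIV. if k = i then (if i \<in> G then (mat 1 - P) $ i $ j else 0) else 0)"
    unfolding matrix_matrix_mult_nth selector_matrix_def by (rule sum.cong) auto
  then show ?thesis by (simp add: green_matrix_def)
qed

lemma stochastic_matrix_green:
  fixes P :: "real ^ 'n ^ 'n"
  assumes "stochastic_matrix P"
  shows "stochastic_matrix (green_matrix P G)"
proof -
  have mat: "stochastic_matrix (mat 1 :: real ^ 'n ^ 'n)"
    by (rule stochastic_matrix_mat_1)
  have "(\<Sum>j\<in>UNIV. green_matrix P G $ i $ j) = 1" for i
    using assms mat
    by (cases "i \<in> G") (simp_all add: green_matrix_nth stochastic_matrix_iff)
  then show ?thesis
    using assms mat by (auto simp: green_matrix_nth stochastic_matrix_iff)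
qed

lemma stochastic_cycle_matrix: "stochastic_matrix P \<Longrightarrow> stochastic_matrix (cycle_matrix P G m)"
  unfolding cycle_matrix_def
  by (intro stochastic_matrix_prod_list) (auto intro: stochastic_matrix_green)

section \<open>Stochastic matrices acting on row vectors\<close>

lemma coord_sum_vector_matrix_mult:
  assumes "stochastic_matrix A"
  shows "coord_sum (x v* A) = coord_sum x"
proof -
  have "coord_sum (x v* A) = (\<Sum>i\<in>UNIV. (\<Sum>j\<in>UNIV. A $ i $ j) * x $ i)"
    unfolding coord_sum_def vector_matrix_mult_nth sum_distrib_right by (rule sum.swap)
  then show ?thesis using assms by (simp add: stochastic_matrix_iff coord_sum_def)
qed

text \<open>Triangle inequality in each coordinate, then exchange of the sums. The row sum
  \<open>c\<close> stays general because the contraction below uses a matrix with row sums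
  \<open>1 - \<eta>\<close>.\<close>

lemma norm1_vector_matrix_mult_le:
  assumes nonneg: "\<And>i j. 0 \<le> A $ i $ j" and rows: "\<And>i. (\<Sum>j\<in>UNIV. A $ i $ j) = c"
  shows "norm1 (x v* A) \<le> c * norm1 x"
proof -
  have "norm1 (x v* A) \<le> (\<Sum>j\<in>UNIV. \<Sum>i\<in>UNIV. A $ i $ j * \<bar>x $ i\<bar>)"
    unfolding norm1_def vector_matrix_mult_nth
    by (intro sum_mono order.trans[OF sum_abs]) (simp add: abs_mult nonneg)
  also have "\<dots> = (\<Sum>i\<in>UNIV. (\<Sum>j\<in>UNIV. A $ i $ j) * \<bar>x $ i\<bar>)"
    unfolding sum_distrib_right by (rule sum.swap)
  also have "\<dots> = c * norm1 x"
    by (simp add: rows norm1_def sum_distrib_left)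
  finally show ?thesis .
qed

lemma norm1_stochastic_le: "stochastic_matrix A \<Longrightarrow> norm1 (x v* A) \<le> norm1 x"
  using norm1_vector_matrix_mult_le[of A 1 x] by (simp add: stochastic_matrix_iff)

lemma norm1_stochastic_contraction:
  fixes A :: "real ^ 'n ^ 'n"
  assumes A: "stochastic_matrix A" and low: "\<And>i. \<eta> \<le> A $ i $ j0" and x: "coord_sum x = 0"
  shows "norm1 (x v* A) \<le> (1 - \<eta>) * norm1 x"
proof -
  define D :: "real ^ 'n ^ 'n" where "D = (\<chi> i j. A $ i $ j - (if j = j0 then \<eta> else 0))"
  have "(x v* A) $ j = (x v* D) $ j" for j
  proof -
    have "(x v* D) $ j
        = (\<Sum>i\<in>UNIV. A $ i $ j * x $ i - (if j = j0 then \<eta> else 0) * x $ i)"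
      by (simp add: vector_matrix_mult_nth D_def left_diff_distrib)
    also have "\<dots> = (x v* A) $ j - (if j = j0 then \<eta> else 0) * coord_sum x"
      by (simp add: sum_subtractf vector_matrix_mult_nth sum_distrib_left coord_sum_def)
    finally show ?thesis using x by simp
  qed
  then have "x v* A = x v* D"
    by (simp add: vec_eq_iff)
  \<comment> \<open>\<open>low\<close> makes column \<open>j0\<close> of \<open>D\<close>
    nonnegative, and each row sum drops from 1 to \<open>1 - \<eta>\<close>.\<close>
  moreover have "norm1 (x v* D) \<le> (1 - \<eta>) * norm1 x"
    using A low
    by (intro norm1_vector_matrix_mult_le)
      (auto simp: D_def stochastic_matrix_iff sum_subtractf)
  ultimately show ?thesis by simp
qed

section \<open>Fixed row vectors of an irreducible chain\<close>

lemma vector_matrix_mult_matrix_power_fixed: "x v* P = x \<Longrightarrow> x v* matrix_power P k = x"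
  by (induction k) (simp_all flip: vector_matrix_mul_assoc)

text \<open>Some power of \<open>P\<close> carries mass from \<open>i\<close> to \<open>j\<close>.
  The vector is fixed by that power too, and nonnegativity keeps the other terms from cancelling
  this one.\<close>

lemma irreducible_fixed_vector_pos:
  assumes P: "stochastic_matrix P" "irreducible_matrix P"
    and x: "\<And>i. 0 \<le> x $ i" "x v* P = x" "0 < x $ i"
  shows "0 < x $ j"
proof -
  obtain k where k: "0 < matrix_power P k $ i $ j"
    using P(2) by (auto simp: irreducible_matrix_def)
  have "0 < matrix_power P k $ i $ j * x $ i"
    using k x(3) by simp
  also have "\<dots> \<le> (x v* matrix_power P k) $ j"
    unfolding vector_matrix_mult_nth
    using stochastic_matrix_power[OF P(1), of k] x(1)
    by (intro member_le_sum[of i UNIV "\<lambda>i. matrix_power P k $ i $ j * x $ i"])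
      (auto simp: stochastic_matrix_iff)
  also have "\<dots> = x $ j"
    by (simp add: vector_matrix_mult_matrix_power_fixed x(2))
  finally show ?thesis .
qed

text \<open>The vector of absolute values is fixed as well, hence so is the positive part of
  \<open>v\<close>, which by irreducibility is either zero or positive everywhere. The latter
  contradicts sum 0.\<close>

lemma irreducible_fixed_vector_eq_0:
  fixes P :: "real ^ 'n ^ 'n"
  assumes P: "stochastic_matrix P" "irreducible_matrix P"
    and v: "v v* P = v" "coord_sum v = 0"
  shows "v = 0"
proof -
  define w :: "real ^ 'n" where "w = (\<chi> i. \<bar>v $ i\<bar>)"
  have le: "w $ j \<le> (w v* P) $ j" for j
  proof -
    have "w $ j = \<bar>\<Sum>i\<in>UNIV. P $ i $ j * v $ i\<bar>"
      by (metis v(1) vector_matrix_mult_nth w_def vec_lambda_beta)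
    also have "\<dots> \<le> (\<Sum>i\<in>UNIV. \<bar>P $ i $ j * v $ i\<bar>)"
      by (rule sum_abs)
    also have "\<dots> = (w v* P) $ j"
      using P(1) by (simp add: vector_matrix_mult_nth w_def abs_mult stochastic_matrix_iff)
    finally show ?thesis .
  qed
  \<comment> \<open>\<open>P\<close> preserves the coordinate sum, so the nonnegative differences
    from \<open>le\<close> add up to 0 and each is 0.\<close>
  have "(\<Sum>j\<in>UNIV. (w v* P) $ j - w $ j) = 0"
    using coord_sum_vector_matrix_mult[OF P(1), of w]
    by (simp add: coord_sum_def sum_subtractf)
  then have "w v* P = w"
    using le by (subst (asm) sum_nonneg_eq_0_iff) (auto simp: vec_eq_iff)
  \<comment> \<open>\<open>w + v\<close> is twice the positive part of \<open>v\<close>.\<close>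
  then have u: "(w + v) v* P = w + v"
    by (simp add: v(1) vector_matrix_left_distrib)
  have nonpos: "v $ i \<le> 0" for i
  proof (rule ccontr)
    assume "\<not> v $ i \<le> 0"
    then have "0 < (w + v) $ i" by (simp add: w_def)
    then have "0 < (w + v) $ j" for j
      using irreducible_fixed_vector_pos[OF P _ u, of i j] by (simp add: w_def)
    then have "0 < \<bar>v $ j\<bar> + v $ j" for j
      by (simp add: w_def)
    then have "0 < v $ j" for j
      by (smt (verit))
    then have "0 < coord_sum v"
      unfolding coord_sum_def by (intro sum_pos) auto
    then show False using v(2) by simp
  qed
  have "(\<Sum>i\<in>UNIV. - v $ i) = 0"
    using v(2) by (simp add: coord_sum_def sum_negf)
  then show ?thesis
    using nonpos by (subst (asm) sum_nonneg_eq_0_iff) (auto simp: vec_eq_iff)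
qed

text \<open>An injective linear map on a finite-dimensional subspace is bounded below in the
  Euclidean norm; passing to \<open>norm1\<close> changes only the constant.\<close>

lemma irreducible_bounded_below:
  fixes P :: "real ^ 'n ^ 'n"
  assumes P: "stochastic_matrix P" "irreducible_matrix P"
  obtains K where "0 < K" "\<And>v. coord_sum v = 0 \<Longrightarrow> norm1 v \<le> K * norm1 (v v* (mat 1 - P))"
proof -
  let ?S = "{v :: real ^ 'n. coord_sum v = 0}" and ?f = "\<lambda>v. v v* (mat 1 - P)"
  have S: "subspace ?S"
    by (auto simp: subspace_def coord_sum_add coord_sum_scaleR)
  have "\<exists>e>0. \<forall>v\<in>?S. norm (?f v) \<ge> e * norm v"
  proof (rule injective_imp_isometric)
    show "closed ?S" by (rule closed_subspace[OF S])
    show "subspace ?S" by (rule S)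
    show "bounded_linear ?f"
      using matrix_vector_mul_bounded_linear[of "transpose (mat 1 - P)"]
      unfolding transpose_matrix_vector .
    show "\<forall>v\<in>?S. ?f v = 0 \<longrightarrow> v = 0"
    proof (intro ballI impI)
      fix v assume "v \<in> ?S" "?f v = 0"
      moreover from this have "v v* P = v"
        by (simp add: vector_matrix_mult_diff_rdistrib)
      ultimately show "v = 0"
        using irreducible_fixed_vector_eq_0[OF P] by simp
    qed
  qed
  then obtain e where e: "e > 0" "\<And>v. coord_sum v = 0 \<Longrightarrow> e * norm v \<le> norm (?f v)"
    by auto
  show thesis
  proof
    \<comment> \<open>\<open>CARD('n)\<close> comes from bounding \<open>norm1 v\<close> by
      \<open>norm v\<close>; on the image side \<open>norm\<close> is at most \<open>norm1\<close>,
      so only \<open>1 / e\<close> enters.\<close>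
    show "0 < real CARD('n) / e" using e(1) by simp
    fix v :: "real ^ 'n" assume v: "coord_sum v = 0"
    have "norm1 v \<le> real CARD('n) * norm v" by (rule norm1_le_card_mult_norm)
    also have "norm v \<le> norm1 (?f v) / e"
      using e(2)[OF v] norm_le_norm1[of "?f v"] e(1) by (simp add: field_simps)
    finally show "norm1 v \<le> real CARD('n) / e * norm1 (?f v)"
      by (simp add: mult_left_mono)
  qed
qed

section \<open>The cash vector over full cycles\<close>

lemma rlgl_C_Suc_Suc:
  "rlgl_C P M0 G (Suc (Suc t)) = rlgl_C P M0 G (Suc t) v* green_matrix P (G (Suc t))"
  \<comment> \<open>From time 1 on the move is selected from the cash vector, so the update is
    multiplication by a green-light matrix. The move at time 0 is \<open>M0\<close> instead, hence
    the double successor.\<close>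
  by (simp add: green_matrix_def vector_matrix_mult_diff_rdistrib
      rlgl_C.simps(2)[of P M0 G "Suc t"] del: rlgl_C.simps flip: vector_matrix_mul_assoc)

lemma rlgl_C_prod_list:
  "rlgl_C P M0 G (Suc s + k)
     = rlgl_C P M0 G (Suc s) v* matrix_prod_list (map (\<lambda>l. green_matrix P (G l)) [Suc s..<Suc s + k])"
\<comment> \<open>The first matrix is peeled off on the left, so the starting time must
  vary.\<close>
proof (induction k arbitrary: s)
  case 0
  then show ?case by (simp add: matrix_prod_list_def)
next
  case (Suc k)
  have "[Suc s..<Suc s + Suc k] = Suc s # [Suc (Suc s)..<Suc (Suc s) + k]"
    by (simp add: upt_conv_Cons)
  then show ?case
    using Suc[of "Suc s"]
    by (simp add: matrix_prod_list_def rlgl_C_Suc_Suc vector_matrix_mul_assoc del: rlgl_C.simps)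
qed

text \<open>Cycles begin at the times \<open>Suc (n * m)\<close>. By periodicity the next
  \<open>m\<close> green-light matrices are those of the first cycle, so each cycle multiplies by
  the same matrix.\<close>

lemma rlgl_C_cycle_power:
  assumes "\<And>n l. 1 \<le> l \<Longrightarrow> l \<le> m \<Longrightarrow> G (n * m + l) = B l"
  shows "rlgl_C P M0 G (Suc (n * m + k * m))
    = rlgl_C P M0 G (Suc (n * m)) v* matrix_power (cycle_matrix P G m) k"
proof (induction k arbitrary: n)
  case 0
  then show ?case by simp
next
  case (Suc k)
  have "map (\<lambda>l. green_matrix P (G l)) [Suc (n * m)..<Suc (n * m) + m]
      = map (\<lambda>l. green_matrix P (G l)) [1..<Suc m]"
  proof (rule nth_equalityI)
    fix i assume "i < length (map (\<lambda>l. green_matrix P (G l)) [Suc (n * m)..<Suc (n * m) + m])"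
    then have "i < m" by (simp del: upt_Suc)
    then have "G (Suc (n * m) + i) = G (1 + i)"
      using assms[of "Suc i" n] assms[of "Suc i" 0] by simp
    then show "map (\<lambda>l. green_matrix P (G l)) [Suc (n * m)..<Suc (n * m) + m] ! i
        = map (\<lambda>l. green_matrix P (G l)) [1..<Suc m] ! i"
      using \<open>i < m\<close> by (simp del: upt_Suc)
  qed simp
  then have "rlgl_C P M0 G (Suc (Suc n * m)) = rlgl_C P M0 G (Suc (n * m)) v* cycle_matrix P G m"
    using rlgl_C_prod_list[of P M0 G "n * m" m]
    by (simp add: cycle_matrix_def add.commute del: rlgl_C.simps)
  then show ?case
    using Suc[of "Suc n"]
    by (simp add: vector_matrix_mul_assoc algebra_simps del: rlgl_C.simps)
qed

lemma coord_sum_rlgl_C: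
  assumes "stochastic_matrix P"
  shows "coord_sum (rlgl_C P M0 G t) = 0"
  by (induction t)
    (simp_all add: coord_sum_diff vector_matrix_mult_diff_rdistrib
      coord_sum_vector_matrix_mult[OF assms])

text \<open>Green-light matrices are stochastic, so the norm does not grow after time 1. This covers
  the incomplete block after the last full one.\<close>

lemma norm1_rlgl_C_Suc_le:
  assumes "stochastic_matrix P"
  shows "norm1 (rlgl_C P M0 G (Suc (s + k))) \<le> norm1 (rlgl_C P M0 G (Suc s))"
proof (induction k)
  case (Suc k)
  then show ?case
    using norm1_stochastic_le[OF stochastic_matrix_green[OF assms]]
    by (simp add: rlgl_C_Suc_Suc del: rlgl_C.simps) (meson order.trans)
qed simp

text \<open>Source of the constant 2: the first cash vector is a difference of two probability
  vectors.\<close>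

lemma norm1_rlgl_C_1_le:
  assumes P: "stochastic_matrix P" and M0: "probability_vector M0"
  shows "norm1 (rlgl_C P M0 G (Suc 0)) \<le> 2"
proof -
  have "norm1 (rlgl_C P M0 G (Suc 0)) \<le> norm1 (M0 v* P) + norm1 M0"
    using norm1_triangle_diff[of "M0 v* P" M0] by (simp add: vector_matrix_mult_diff_rdistrib)
  then show ?thesis
    using norm1_stochastic_le[OF P, of M0] norm1_probability_vector[OF M0] by simp
qed

text \<open>Blocks of \<open>r * m\<close> steps are counted from time 1, so for
  \<open>r * m > 0\<close> the exponent is the number of blocks completed by time
  \<open>Suc s\<close>.\<close>

lemma norm1_rlgl_C_le:
  assumes P: "stochastic_matrix P" and M0: "probability_vector M0"
    and G: "\<And>n l. 1 \<le> l \<Longrightarrow> l \<le> m \<Longrightarrow> G (n * m + l) = B l"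
    and low: "\<And>i. \<eta> \<le> matrix_power (cycle_matrix P G m) r $ i $ j0" and "\<eta> \<le> 1"
  shows "norm1 (rlgl_C P M0 G (Suc s)) \<le> 2 * (1 - \<eta>) ^ (s div (r * m))"
proof -
  have block: "norm1 (rlgl_C P M0 G (Suc (q * (r * m)))) \<le> 2 * (1 - \<eta>) ^ q" for q
  proof (induction q)
    case 0
    then show ?case using norm1_rlgl_C_1_le[OF P M0] by simp
  next
    case (Suc q)
    \<comment> \<open>A block consists of \<open>r\<close> cycles, so it multiplies by the matrix
      that \<open>low\<close> bounds.\<close>
    have "rlgl_C P M0 G (Suc (Suc q * (r * m)))
        = rlgl_C P M0 G (Suc (q * (r * m))) v* matrix_power (cycle_matrix P G m) r"
      using rlgl_C_cycle_power[where G = G and n = "q * r" and k = r and m = m, OF G]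
      by (simp add: algebra_simps del: rlgl_C.simps)
    then have "norm1 (rlgl_C P M0 G (Suc (Suc q * (r * m))))
        \<le> (1 - \<eta>) * norm1 (rlgl_C P M0 G (Suc (q * (r * m))))"
      using norm1_stochastic_contraction[OF
          stochastic_matrix_power[OF stochastic_cycle_matrix[OF P]] low coord_sum_rlgl_C[OF P]]
      by (simp del: rlgl_C.simps)
    also have "\<dots> \<le> (1 - \<eta>) * (2 * (1 - \<eta>) ^ q)"
      using \<open>\<eta> \<le> 1\<close> by (intro mult_left_mono Suc) simp
    finally show ?case by (simp add: mult_ac)
  qed
  have "norm1 (rlgl_C P M0 G (Suc (s div (r * m) * (r * m) + s mod (r * m))))
      \<le> 2 * (1 - \<eta>) ^ (s div (r * m))"
    using norm1_rlgl_C_Suc_le[OF P] block by (rule order.trans)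
  then show ?thesis by (simp only: div_mult_mod_eq)
qed

section \<open>From block counts to a real exponent\<close>

lemma power_div_le_powr:
  fixes \<eta> :: real
  assumes \<eta>: "0 \<le> \<eta>" "\<eta> < 1" and "0 < k"
  shows "(1 - \<eta>) ^ (s div k) \<le> inverse (1 - \<eta>\<^sup>2) * (1 - \<eta>\<^sup>2) powr (real (Suc s) / real k)"
proof -
  have sq: "\<eta>\<^sup>2 \<le> \<eta>"
    using \<eta> by (simp add: power2_eq_square mult_left_le)
  have pos: "0 < 1 - \<eta>\<^sup>2"
    using \<eta> sq by simp
  \<comment> \<open>Rounding down loses at most one block, which costs the prefactor
    \<open>inverse (1 - \<eta>\<^sup>2)\<close>. The strict bound on the remainder absorbs the shift
    from \<open>s\<close> to \<open>Suc s\<close>.\<close>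
  have "Suc s \<le> (s div k + 1) * k"
    using \<open>0 < k\<close> dividend_less_div_times[of k s] by simp
  then have "real (Suc s) \<le> real ((s div k + 1) * k)"
    by (simp only: of_nat_le_iff)
  then have exponent: "real (Suc s) / real k - 1 \<le> real (s div k)"
    using \<open>0 < k\<close> by (simp add: field_simps)
  have "(1 - \<eta>) ^ (s div k) \<le> (1 - \<eta>\<^sup>2) ^ (s div k)"
    using \<eta> sq by (intro power_mono) auto
  also have "\<dots> = (1 - \<eta>\<^sup>2) powr real (s div k)"
    using pos by (simp add: powr_realpow)
  also have "\<dots> \<le> (1 - \<eta>\<^sup>2) powr (real (Suc s) / real k - 1)"
    using pos exponent by (intro powr_mono') auto
  also have "\<dots> = inverse (1 - \<eta>\<^sup>2) * (1 - \<eta>\<^sup>2) powr (real (Suc s) / real k)"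
    using pos by (simp add: powr_diff field_simps)
  finally show ?thesis .
qed

lemma norm1_rlgl_C_le_powr:
  assumes P: "stochastic_matrix P" and M0: "probability_vector M0"
    and G: "\<And>n l. 1 \<le> l \<Longrightarrow> l \<le> m \<Longrightarrow> G (n * m + l) = B l"
    and low: "\<And>i. \<eta> \<le> matrix_power (cycle_matrix P G m) r $ i $ j0"
    and \<eta>: "0 \<le> \<eta>" "\<eta> < 1" and rm: "0 < r * m"
  shows "norm1 (rlgl_C P M0 G t)
    \<le> 2 * inverse (1 - \<eta>\<^sup>2) * (1 - \<eta>\<^sup>2) powr (real t / real (r * m))"
proof (cases t)
  case 0
  have "0 \<le> 1 - \<eta>\<^sup>2"
    using \<eta> by (simp add: power_le_one)
  then show ?thesis using 0 by simp
next
  case (Suc s)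
  have "norm1 (rlgl_C P M0 G (Suc s)) \<le> 2 * (1 - \<eta>) ^ (s div (r * m))"
    using norm1_rlgl_C_le[where G = G, OF P M0 G low] \<eta>(2) by simp
  also have "\<dots> \<le> 2 * (inverse (1 - \<eta>\<^sup>2) * (1 - \<eta>\<^sup>2) powr (real (Suc s) / real (r * m)))"
    by (intro mult_left_mono power_div_le_powr \<eta> rm) simp
  finally show ?thesis by (simp only: Suc mult.assoc)
qed

section \<open>Error of the estimate\<close>

lemma rlgl_H_mult: "rlgl_H P M0 G t v* (mat 1 - P) = - rlgl_C P M0 G t"
  \<comment> \<open>\<open>H\<close> sums the moves and \<open>C\<close> sums
    \<open>- M v* (mat 1 - P)\<close> over the same moves, both from 0.\<close>
  by (induction t) (simp_all add: vector_matrix_left_distrib)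

lemma norm1_rlgl_estimate_le:
  fixes P :: "real ^ 'n ^ 'n"
  assumes K: "\<And>v. coord_sum v = 0 \<Longrightarrow> norm1 v \<le> K * norm1 (v v* (mat 1 - P))"
    and stat: "stationary_distribution P \<pi>" and nz: "coord_sum (rlgl_H P M0 G t) \<noteq> 0"
  shows "norm1 (rlgl_estimate P M0 G t - \<pi>)
    \<le> K * norm1 (rlgl_C P M0 G t) / \<bar>coord_sum (rlgl_H P M0 G t)\<bar>"
proof -
  define h where "h = coord_sum (rlgl_H P M0 G t)"
  \<comment> \<open>Subtracting \<open>h *\<^sub>R \<pi>\<close> makes the sum 0 without changing
    the image under \<open>mat 1 - P\<close>, so \<open>K\<close> bounds the error by the cash
    vector.\<close>
  define v where "v = rlgl_H P M0 G t - h *\<^sub>R \<pi>"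
  have \<pi>: "coord_sum \<pi> = 1" "\<pi> v* (mat 1 - P) = 0"
    using stat
    by (auto simp: stationary_distribution_def probability_vector_def
        vector_matrix_mult_diff_rdistrib)
  have "v v* (mat 1 - P) = - rlgl_C P M0 G t"
    by (simp add: v_def vector_matrix_mult_diff_distrib rlgl_H_mult scaleR_vector_matrix_assoc \<pi>)
  moreover have "coord_sum v = 0"
    by (simp add: v_def coord_sum_diff coord_sum_scaleR \<pi> h_def)
  ultimately have "norm1 v \<le> K * norm1 (rlgl_C P M0 G t)"
    using K[of v] norm1_scaleR[of "-1" "rlgl_C P M0 G t"] by simp
  moreover have "rlgl_estimate P M0 G t - \<pi> = inverse h *\<^sub>R v"
    using nz by (simp add: rlgl_estimate_def v_def h_def scaleR_diff_right)
  ultimately show ?thesis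
    using nz by (simp add: norm1_scaleR h_def divide_simps)
qed

theorem theorem11:
  fixes P :: "real ^ 'n ^ 'n"
    and pi_star M0 :: "real ^ 'n"
    and B G :: "nat \<Rightarrow> 'n set"
    and m r :: nat
    and j0 :: 'n
    and \<eta> :: real
  assumes "ergodic_matrix P"
    and "stationary_distribution P pi_star"
    and "probability_vector M0"
    and "1 \<le> m"
    and "(\<Union>l\<in>{1..m}. B l) = UNIV"
    and "G 0 = UNIV"
    and "\<And>n l. 1 \<le> l \<Longrightarrow> l \<le> m \<Longrightarrow> G (n * m + l) = B l"
    and "1 \<le> r"
    and "\<And>i. matrix_power (cycle_matrix P G m) r $ i $ j0 > 0"
    and "\<eta> = (INF i. matrix_power (cycle_matrix P G m) r $ i $ j0)"
  shows "(\<forall>t. norm1 (rlgl_C P M0 G t)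
              = measure_pmf.expectation (return_pmf G) (\<lambda>G'. norm1 (rlgl_C P M0 G' t)))
       \<and> (\<eta> < 1 \<longrightarrow>
           (\<forall>t. measure_pmf.expectation (return_pmf G) (\<lambda>G'. norm1 (rlgl_C P M0 G' t))
              \<le> 2 * inverse (1 - \<eta>\<^sup>2) * (1 - \<eta>\<^sup>2) powr (real t / real (r * m))))
       \<and> ((INF t\<in>{0<..}. \<bar>coord_sum (rlgl_H P M0 G t)\<bar>) > 0 \<longrightarrow>
           (\<lambda>t. norm1 (rlgl_estimate P M0 G t - pi_star))
             \<in> O(\<lambda>t. (1 - \<eta>\<^sup>2) powr (real t / real (r * m))))"
proof -
  note stat = assms(2) and M0 = assms(3) and G = assms(7)
  let ?Q = "matrix_power (cycle_matrix P G m) r"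
  let ?rate = "\<lambda>t. (1 - \<eta>\<^sup>2) powr (real t / real (r * m))"
  have P: "stochastic_matrix P" "irreducible_matrix P"
    using assms(1) by (auto simp: ergodic_matrix_def)
  have rm: "0 < r * m"
    using assms(4,8) by simp
  have low: "\<eta> \<le> ?Q $ i $ j0" for i
    unfolding assms(10) by (rule cINF_lower) auto
  have "0 \<le> \<eta>"
    unfolding assms(10) by (rule cINF_greatest) (auto intro: less_imp_le assms(9))
  moreover have "\<eta> \<le> 1"
    using low stochastic_matrix_entry_le_1[OF stochastic_matrix_power[OF
        stochastic_cycle_matrix[OF P(1)]]] by (rule order.trans)
  ultimately have \<eta>: "0 \<le> \<eta>" "\<eta> \<le> 1" .
  have bound: "norm1 (rlgl_C P M0 G t) \<le> 2 * inverse (1 - \<eta>\<^sup>2) * ?rate t" if "\<eta> < 1" for t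
    by (rule norm1_rlgl_C_le_powr[where G = G, OF P(1) M0 G low \<eta>(1) that rm])
  \<comment> \<open>The big-O claim has to cover \<open>\<eta> = 1\<close> too, so a constant
    \<open>A\<close> is found in either case.\<close>
  have "\<exists>A. \<forall>\<^sub>F t in sequentially. norm1 (rlgl_C P M0 G t) \<le> A * ?rate t"
  proof (cases "\<eta> < 1")
    case True
    then show ?thesis using bound by (intro exI always_eventually) blast
  next
    case False
    \<comment> \<open>Here \<open>\<eta> = 1\<close> and the rate is \<open>0 powr _ = 0\<close>, so the cash vector must vanish exactly.\<close>
    have "norm1 (rlgl_C P M0 G t) \<le> 0 * ?rate t" if "Suc (r * m) \<le> t" for t
    proof -
      obtain s where s: "t = Suc s" "r * m \<le> s"
        using \<open>Suc (r * m) \<le> t\<close> by (metis Suc_le_D Suc_le_mono)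
      \<comment> \<open>At least one full block is complete, so \<open>1 - \<eta> = 0\<close> is
        raised to a positive exponent.\<close>
      then have "s div (r * m) \<noteq> 0"
        using rm by (simp add: div_eq_0_iff)
      then show ?thesis
        using norm1_rlgl_C_le[where G = G, OF P(1) M0 G low \<eta>(2), of s] False \<eta>(2) s(1)
        by (simp add: power_0_left del: rlgl_C.simps)
    qed
    then show ?thesis by (intro exI eventually_sequentiallyI)
  qed
  then obtain A where A: "\<forall>\<^sub>F t in sequentially. norm1 (rlgl_C P M0 G t) \<le> A * ?rate t"
    by blast
  obtain K where K: "0 < K" "\<And>v. coord_sum v = 0 \<Longrightarrow> norm1 v \<le> K * norm1 (v v* (mat 1 - P))"
    using irreducible_bounded_below[OF P] by blast
  have "(\<lambda>t. norm1 (rlgl_estimate P M0 G t - pi_star)) \<in> O(?rate)"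
    if inf: "(INF t\<in>{0<..}. \<bar>coord_sum (rlgl_H P M0 G t)\<bar>) > 0" (is "?c > 0")
  proof (rule bigoI)
    show "\<forall>\<^sub>F t in sequentially. norm (norm1 (rlgl_estimate P M0 G t - pi_star))
        \<le> K * A / ?c * norm (?rate t)"
      \<comment> \<open>The infimum ranges over positive times; at time 0 the coordinate sum is
        0.\<close>
      using A eventually_gt_at_top[of 0]
    proof eventually_elim
      fix t :: nat
      assume t: "norm1 (rlgl_C P M0 G t) \<le> A * ?rate t" "0 < t"
      have c: "?c \<le> \<bar>coord_sum (rlgl_H P M0 G t)\<bar>"
        using t(2) by (intro cINF_lower) (auto intro!: bdd_belowI2[of _ 0])
      have "norm1 (rlgl_estimate P M0 G t - pi_star)
          \<le> K * norm1 (rlgl_C P M0 G t) / \<bar>coord_sum (rlgl_H P M0 G t)\<bar>"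
        using c inf by (intro norm1_rlgl_estimate_le K stat) auto
      \<comment> \<open>\<open>frac_le\<close> needs a nonnegative numerator. The sign of
        \<open>A\<close> is unknown, so nonnegativity comes from the norm that
        \<open>A * ?rate t\<close> bounds.\<close>
      also have "\<dots> \<le> K * (A * ?rate t) / ?c"
        using t(1) K(1) c inf order.trans[OF norm1_nonneg t(1)]
        by (intro frac_le mult_left_mono mult_nonneg_nonneg[of K]) auto
      finally show "norm (norm1 (rlgl_estimate P M0 G t - pi_star)) \<le> K * A / ?c * norm (?rate t)"
        by (simp add: norm1_nonneg)
    qed
  qed
  \<comment> \<open>The green-light sets are deterministic: the expectation under the point mass
    \<open>return_pmf G\<close> is the value at \<open>G\<close>.\<close>
  then show ?thesis
    using bound by simp
qed

end
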